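(* Let $d,\delta,b\in\mathbb N$, let $D\subseteq\mathbb R^d$, let $V\subseteq C(D,\mathbb R^\delta)$, let $W\subseteq\partial D$, let $\mathscr D\colon V\to C(D,\mathbb R^\delta)$ and $\mathscr B\colon V\to C(W,\mathbb R^b)$ be functions, let $u\in V$ satisfy for all $x\in D$, $y\in W$ that $$(\mathscr D(u))(x)=0\qquad\text{and}\qquad(\mathscr B(u))(y)=0,$$ let $(\Omega,\mathcal F,\mathbb P)$ be a probability space, let $\mathbb X\colon\Omega\to D$ and $\mathbb Y\colon\Omega\to W$ be independent random variables, assume for all open sets $\mathcal X,\mathcal Y\subseteq\mathbb R^d$ with $\mathcal X\cap D\neq\emptyset$ and $\mathcal Y\cap W\neq\emptyset$ that $\mathbb P(\{\mathbb X\in\mathcal X\}\cap\{\mathbb Y\in\mathcal Y\})>0$, let $\ell\colon V\to[0,\infty]$ satisfy for all $v\in V$ that $$\ell(v)=\mathbb E\bigl[\|(\mathscr D(v))(\mathbb X)\|^2+\|(\mathscr B(v))(\mathbb Y)\|^2\bigr],$$ and let $v\in V$. Then the following two statements are equivalent: (i) It holds that $\ell(v)=\inf_{w\in V}\ell(w)$. (ii) It holds for all $x\in D$, $y\in W$ that $(\mathscr D(v))(x)=0$ and $(\mathscr B(v))(y)=0$.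
   Context: $\mathbb N=\{1,2,3,\dots\}$. $\|\cdot\|$ is the Euclidean norm. $\partial D$ is the topological boundary of $D$ in $\mathbb R^d$. For a subset $A$ of a Euclidean space, $C(A,\mathbb R^k)$ is the set of continuous functions from $A$ (with the subspace topology) to $\mathbb R^k$. Random variables with values in $D$ or $W$ are measurable with respect to the respective Borel sigma-algebras. The maps $\mathscr D$ and $\mathscr B$ are arbitrary (not assumed linear or continuous). *)

theory Defs
  imports "HOL-Probability.Probability"
begin

(* C(A, R^k). Functions on a set A are total functions that take the value undefined outside A,
   so that two elements are equal iff they agree on A and, in particular, a map defined on a
   set of such functions can depend only on their values on A. *)
definition cont_funs :: "'a::topological_space set \<Rightarrow> ('a \<Rightarrow> 'b::topological_space) set"
  where "cont_funs A = {f \<in> extensional A. continuous_on A f}"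

end

(* The loss is the integral of a nonnegative function and vanishes at u, so its infimum is 0. A
   minimiser therefore has residuals vanishing almost surely along X and Y. As X and Y charge every
   open set meeting D and W, a continuous residual that is nonzero at one point would be nonzero
   with positive probability. *)

theory Submission
  imports Defs
begin

text \<open>By continuity, a nonzero value persists on a relatively open piece of \<open>S\<close>.
  As \<open>X\<close> takes values in \<open>S\<close>, hitting that piece has positive probability,
  yet it forces \<open>f (X \<omega>)\<close> to be nonzero, which happens only on a null
  set.\<close>

lemma continuous_on_eq_zero_of_AE:
  fixes f :: "'a::topological_space \<Rightarrow> 'b::real_normed_vector"
  assumes cont: "continuous_on S f"
    and X: "X \<in> M \<rightarrow>\<^sub>M restrict_space borel S"
    and pos: "\<And>U. open U \<Longrightarrow> U \<inter> S \<noteq> {} \<Longrightarrow> measure M {\<omega> \<in> space M. X \<omega> \<in> U} > 0"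
    and AE: "AE \<omega> in M. f (X \<omega>) = 0"
    and x: "x \<in> S"
  shows "f x = 0"
proof (rule ccontr)
  assume "f x \<noteq> 0"
  \<comment> \<open>Positivity is assumed for open sets of the ambient space, so the relatively open
    set where \<open>f\<close> is nonzero is written as the trace on \<open>S\<close> of such a
    \<open>U\<close>.\<close>
  obtain U where U: "open U" "U \<inter> S = f -` (- {0}) \<inter> S"
    using cont unfolding continuous_on_open_invariant by (metis open_Compl closed_singleton)
  have "U \<inter> S \<noteq> {}"
    using U x \<open>f x \<noteq> 0\<close> by auto
  have X_in: "X \<omega> \<in> S" if "\<omega> \<in> space M" for \<omega>
    using measurable_space[OF X that] by (simp add: space_restrict_space)
  from AE have "AE \<omega> in M. \<not> (\<omega> \<in> space M \<and> X \<omega> \<in> U)"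
    by eventually_elim (use U(2) X_in in blast)
  then have "measure M {\<omega> \<in> space M. X \<omega> \<in> U} = 0"
    by (simp add: measure_def emeasure_eq_0_AE)
  then show False
    using pos[OF U(1) \<open>U \<inter> S \<noteq> {}\<close>] by simp
qed

theorem theorem2p4:
  fixes D W :: "(real ^ 'd) set"
    and V :: "(real ^ 'd \<Rightarrow> real ^ 'e) set"
    and \<D> :: "(real ^ 'd \<Rightarrow> real ^ 'e) \<Rightarrow> (real ^ 'd \<Rightarrow> real ^ 'e)"
    and \<B> :: "(real ^ 'd \<Rightarrow> real ^ 'e) \<Rightarrow> (real ^ 'd \<Rightarrow> real ^ 'b)"
    and u v :: "real ^ 'd \<Rightarrow> real ^ 'e"
    and M :: "'w measure"
    and X Y :: "'w \<Rightarrow> real ^ 'd"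
    and l :: "(real ^ 'd \<Rightarrow> real ^ 'e) \<Rightarrow> ennreal"
  assumes "V \<subseteq> cont_funs D"
    and "W \<subseteq> frontier D"
    and "\<D> \<in> V \<rightarrow> cont_funs D"
    and "\<B> \<in> V \<rightarrow> cont_funs W"
    and "u \<in> V"
    and "\<forall>x\<in>D. \<forall>y\<in>W. \<D> u x = 0 \<and> \<B> u y = 0"
    and "prob_space M"
    and "X \<in> M \<rightarrow>\<^sub>M restrict_space borel D"
    and "Y \<in> M \<rightarrow>\<^sub>M restrict_space borel W"
    and "prob_space.indep_var M (restrict_space borel D) X (restrict_space borel W) Y"
    and "\<And>\<X> \<Y>. open \<X> \<Longrightarrow> open \<Y> \<Longrightarrow> \<X> \<inter> D \<noteq> {} \<Longrightarrow> \<Y> \<inter> W \<noteq> {} \<Longrightarrow>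
           measure M ({\<omega> \<in> space M. X \<omega> \<in> \<X>} \<inter> {\<omega> \<in> space M. Y \<omega> \<in> \<Y>}) > 0"
    and "\<And>v. v \<in> V \<Longrightarrow>
           l v = (\<integral>\<^sup>+ \<omega>. ennreal ((norm (\<D> v (X \<omega>)))\<^sup>2 + (norm (\<B> v (Y \<omega>)))\<^sup>2) \<partial>M)"
    and "v \<in> V"
  shows "l v = (INF w\<in>V. l w) \<longleftrightarrow> (\<forall>x\<in>D. \<forall>y\<in>W. \<D> v x = 0 \<and> \<B> v y = 0)"
proof -
  interpret prob_space M by fact
  have space: "X \<omega> \<in> D" "Y \<omega> \<in> W" if "\<omega> \<in> space M" for \<omega>
    using measurable_space[OF assms(8) that] measurable_space[OF assms(9) that]
    by (simp_all add: space_restrict_space)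
  have contD: "continuous_on D (\<D> w)" and contB: "continuous_on W (\<B> w)" if "w \<in> V" for w
    using assms(3,4) that by (auto simp: cont_funs_def)
  \<comment> \<open>Serves twice: for \<open>u\<close> it makes the infimum zero, and for
    \<open>v\<close> it gives the implication from (ii) to (i).\<close>
  have l_zero: "l w = 0" if "w \<in> V" "\<forall>x\<in>D. \<forall>y\<in>W. \<D> w x = 0 \<and> \<B> w y = 0" for w
  proof -
    have "l w = (\<integral>\<^sup>+ \<omega>. 0 \<partial>M)"
      unfolding assms(12)[OF that(1)] by (rule nn_integral_cong) (use that(2) space in force)
    then show ?thesis by simp
  qed
  \<comment> \<open>Losses are in \<open>ennreal\<close>, so the upper bound \<open>l u = 0\<close>
    already determines the infimum.\<close>
  have "(INF w\<in>V. l w) \<le> l u"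
    using assms(5) by (rule INF_lower)
  then have inf: "(INF w\<in>V. l w) = 0"
    using l_zero[OF assms(5,6)] by simp
  have "\<D> v x = 0 \<and> \<B> v y = 0" if "l v = 0" "x \<in> D" "y \<in> W" for x y
  proof -
    \<comment> \<open>The integral criterion below needs a measurable integrand. The residuals are
      continuous, hence Borel, only on \<open>D\<close> and \<open>W\<close>; composing through the
      restricted spaces suffices because \<open>X\<close> and \<open>Y\<close> map into
      them.\<close>
    have [measurable]: "(\<lambda>\<omega>. \<D> v (X \<omega>)) \<in> borel_measurable M"
        "(\<lambda>\<omega>. \<B> v (Y \<omega>)) \<in> borel_measurable M"
      using assms(8,9) contD[OF assms(13)] contB[OF assms(13)]
      by (auto intro: measurable_compose borel_measurable_continuous_on_restrict)
    have "AE \<omega> in M. ennreal ((norm (\<D> v (X \<omega>)))\<^sup>2 + (norm (\<B> v (Y \<omega>)))\<^sup>2) = 0"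
      using \<open>l v = 0\<close> assms(12)[OF assms(13)] by (intro nn_integral_0_iff_AE[THEN iffD1]) auto
    then have AE: "AE \<omega> in M. \<D> v (X \<omega>) = 0 \<and> \<B> v (Y \<omega>) = 0"
      by eventually_elim (simp add: ennreal_eq_0_iff sum_power2_le_zero_iff)
    have "measure M {\<omega> \<in> space M. X \<omega> \<in> U} > 0" if "open U" "U \<inter> D \<noteq> {}" for U
    proof -
      \<comment> \<open>Taking \<open>UNIV\<close> for the second open set reduces joint positivity
        to positivity for \<open>X\<close> alone; the point \<open>y\<close> shows that
        \<open>UNIV\<close> meets \<open>W\<close>. For \<open>Y\<close> the roles are swapped, with
        \<open>x\<close> as the point of \<open>D\<close>.\<close>
      have "measure M ({\<omega> \<in> space M. X \<omega> \<in> U} \<inter> {\<omega> \<in> space M. Y \<omega> \<in> UNIV}) > 0"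
        using that \<open>y \<in> W\<close> by (intro assms(11)) auto
      then show ?thesis by (simp add: Int_absorb2)
    qed
    moreover have "measure M {\<omega> \<in> space M. Y \<omega> \<in> U} > 0" if "open U" "U \<inter> W \<noteq> {}" for U
    proof -
      have "measure M ({\<omega> \<in> space M. X \<omega> \<in> UNIV} \<inter> {\<omega> \<in> space M. Y \<omega> \<in> U}) > 0"
        using that \<open>x \<in> D\<close> by (intro assms(11)) auto
      then show ?thesis by (simp add: Int_absorb1)
    qed
    ultimately show ?thesis
      using continuous_on_eq_zero_of_AE[OF contD[OF assms(13)] assms(8) _ _ \<open>x \<in> D\<close>]
        continuous_on_eq_zero_of_AE[OF contB[OF assms(13)] assms(9) _ _ \<open>y \<in> W\<close>] AE
      by auto
  qed
  then show ?thesis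
    using l_zero[OF assms(13)] by (auto simp: inf)
qed

end
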